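(* There is a computable function $m(j,\varepsilon)$ with the following property. There is an oracle algorithm which, given a representation of a shift-invariant Borel probability measure $\mu$ on $2^{\mathbb{N}}$, computes a point $\omega \in 2^{\mathbb{N}}$ that is generic for $\mu$ and moreover satisfies: for every finite binary string $\sigma$ of length $j$, every $\varepsilon > 0$, and every $n \geq m(j,\varepsilon)$, \[ \left| \mu([\sigma]) - \frac{1}{n} \sum_{i < n} 1_{[\sigma]} (T^i \omega) \right| < \varepsilon. \] (The function $m$ does not depend on $\mu$.)
   Context: $2^{\mathbb{N}}$ is Cantor space; $[\sigma]$ is the set of infinite binary sequences extending the finite string $\sigma$; $T$ is the left shift $(T\omega)(k)=\omega(k+1)$; shift-invariance means $\mu(T^{-1}B)=\mu(B)$ for all Borel $B$. A representation of $\mu$ is a function $f$ from (finite binary strings)$\times\mathbb{N}$ to $\mathbb{Q}$ with $|\mu([\sigma]) - f(\sigma,i)| < 2^{-i}$; computing $\omega$ means computing the function $k\mapsto\omega(k)$, with finitely many queries to the representation for each output bit. A point $\omega$ is generic for $\mu$ if for every finite binary string $\sigma$, $\mu([\sigma]) = \lim_{n\to\infty} \frac1n\sum_{i<n} 1_{[\sigma]}(T^i\omega)$. *)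

theory Defs
  imports "HOL-Probability.Probability" "HOL-Library.Nat_Bijection"
begin

section \<open>Oracle computability\<close>

text \<open>
  Terms for the partial recursive functions (of any arity) relative to an oracle
  \<open>h :: nat \<Rightarrow> nat\<close>.  \<open>PrimRec f g\<close> recurses on its first argument, \<open>g\<close> receiving
  the counter, the previous value and the parameters in this order; \<open>Minim f\<close> is unbounded
  search over the first argument of \<open>f\<close>.  The result is \<open>None\<close> on divergence or wrong arity.
\<close>

datatype recfun =
    Zero
  | Succ
  | Proj nat
  | Oracle
  | Comp recfun "recfun list"
  | PrimRec recfun recfun
  | Minim recfun

definition minimize :: "(nat \<Rightarrow> nat option) \<Rightarrow> nat option" where
  "minimize g =
    (if \<exists>n. g n = Some 0 \<and> (\<forall>i<n. \<exists>y. g i = Some (Suc y))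
     then Some (LEAST n. g n = Some 0) else None)"

fun eval :: "(nat \<Rightarrow> nat) \<Rightarrow> recfun \<Rightarrow> nat list \<Rightarrow> nat option" where
  "eval h Zero xs = Some 0"
| "eval h Succ xs = (case xs of [x] \<Rightarrow> Some (Suc x) | _ \<Rightarrow> None)"
| "eval h (Proj i) xs = (if i < length xs then Some (xs ! i) else None)"
| "eval h Oracle xs = (case xs of [x] \<Rightarrow> Some (h x) | _ \<Rightarrow> None)"
| "eval h (Comp f gs) xs = Option.bind (those (map (\<lambda>g. eval h g xs) gs)) (eval h f)"
| "eval h (PrimRec f g) xs =
    (case xs of
       [] \<Rightarrow> None
     | n # ys \<Rightarrow>
         rec_nat (eval h f ys) (\<lambda>k r. Option.bind r (\<lambda>v. eval h g (k # v # ys))) n)"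
| "eval h (Minim f) xs = minimize (\<lambda>n. eval h f (n # xs))"

fun oracle_free :: "recfun \<Rightarrow> bool" where
  "oracle_free Oracle \<longleftrightarrow> False"
| "oracle_free (Comp f gs) \<longleftrightarrow> oracle_free f \<and> (\<forall>g\<in>set gs. oracle_free g)"
| "oracle_free (PrimRec f g) \<longleftrightarrow> oracle_free f \<and> oracle_free g"
| "oracle_free (Minim f) \<longleftrightarrow> oracle_free f"
| "oracle_free _ \<longleftrightarrow> True"

lemma minimize_eq_Some_iff:
  "minimize g = Some n \<longleftrightarrow> g n = Some 0 \<and> (\<forall>i<n. \<exists>y. g i = Some (Suc y))"
proof -
  have least: "(LEAST n. g n = Some 0) = m"
    if "g m = Some 0" "\<forall>i<m. \<exists>y. g i = Some (Suc y)" for m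
    by (rule Least_equality) (use that in \<open>auto simp: not_less [symmetric]\<close>)
  show ?thesis
    unfolding minimize_def using least by auto
qed

lemma eval_rec_use:
  assumes f: "\<And>xs y. eval h f xs = Some y \<Longrightarrow>
      \<exists>Q. finite Q \<and> (\<forall>h'. (\<forall>q\<in>Q. h' q = h q) \<longrightarrow> eval h' f xs = Some y)"
    and g: "\<And>xs y. eval h g xs = Some y \<Longrightarrow>
      \<exists>Q. finite Q \<and> (\<forall>h'. (\<forall>q\<in>Q. h' q = h q) \<longrightarrow> eval h' g xs = Some y)"
    and y: "eval h (PrimRec f g) (n # ys) = Some y"
  shows "\<exists>Q. finite Q \<and>
      (\<forall>h'. (\<forall>q\<in>Q. h' q = h q) \<longrightarrow> eval h' (PrimRec f g) (n # ys) = Some y)"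
  using y
proof (induction n arbitrary: y)
  case 0
  then show ?case using f by simp
next
  case (Suc n)
  then obtain v where v: "eval h (PrimRec f g) (n # ys) = Some v"
    and w: "eval h g (n # v # ys) = Some y"
    by (auto simp: bind_eq_Some_conv)
  obtain Q where Q: "finite Q"
    "\<And>h'. \<forall>q\<in>Q. h' q = h q \<Longrightarrow> eval h' (PrimRec f g) (n # ys) = Some v"
    using Suc.IH[OF v] by blast
  obtain R where R: "finite R"
    "\<And>h'. \<forall>q\<in>R. h' q = h q \<Longrightarrow> eval h' g (n # v # ys) = Some y"
    using g[OF w] by blast
  have "eval h' (PrimRec f g) (Suc n # ys) = Some y" if "\<forall>q\<in>Q \<union> R. h' q = h q" for h'
  proof -
    have "eval h' (PrimRec f g) (n # ys) = Some v" "eval h' g (n # v # ys) = Some y"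
      using that Q(2) R(2) by auto
    then show ?thesis by simp
  qed
  then show ?case using Q(1) R(1) by (intro exI[of _ "Q \<union> R"]) simp
qed

lemma those_eq_Some_iff: "those xs = Some ys \<longleftrightarrow> xs = map Some ys"
proof (induction xs arbitrary: ys)
  case (Cons x xs)
  then show ?case by (cases x; cases ys) auto
qed auto

text \<open>The use principle: a convergent computation depends on finitely many oracle values.\<close>

lemma eval_use:
  assumes "eval h p xs = Some y"
  shows "\<exists>Q. finite Q \<and> (\<forall>h'. (\<forall>q\<in>Q. h' q = h q) \<longrightarrow> eval h' p xs = Some y)"
  using assms
proof (induction p arbitrary: xs y)
  case Zero
  then show ?case by (intro exI[of _ "{}"]) simp
next
  case Succ
  then show ?case by (intro exI[of _ "{}"]) simp
next
  case (Proj i)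
  then show ?case by (intro exI[of _ "{}"]) simp
next
  case Oracle
  then obtain x where "xs = [x]" "y = h x" by (auto split: list.splits)
  then show ?case by (intro exI[of _ "{x}"]) simp
next
  case (Comp f gs)
  from Comp.prems obtain vs where vs: "map (\<lambda>g. eval h g xs) gs = map Some vs"
    and y: "eval h f vs = Some y"
    by (auto simp: bind_eq_Some_conv those_eq_Some_iff)
  obtain Q where Q: "finite Q" "\<And>h'. \<forall>q\<in>Q. h' q = h q \<Longrightarrow> eval h' f vs = Some y"
    using Comp.IH(1)[OF y] by blast
  have "\<exists>R. finite R \<and> (\<forall>h'. (\<forall>q\<in>R. h' q = h q) \<longrightarrow> eval h' g xs = eval h g xs)"
    if g: "g \<in> set gs" for g
  proof -
    have "eval h g xs \<in> set (map (\<lambda>g. eval h g xs) gs)" using g by simp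
    then obtain v where v: "eval h g xs = Some v" unfolding vs by auto
    show ?thesis using Comp.IH(2)[OF g v] unfolding v .
  qed
  then have "\<exists>R. \<forall>g\<in>set gs. finite (R g) \<and>
      (\<forall>h'. (\<forall>q\<in>R g. h' q = h q) \<longrightarrow> eval h' g xs = eval h g xs)"
    by (intro bchoice ballI)
  then obtain R where R: "\<And>g. g \<in> set gs \<Longrightarrow> finite (R g)"
    "\<And>g h'. g \<in> set gs \<Longrightarrow> \<forall>q\<in>R g. h' q = h q \<Longrightarrow> eval h' g xs = eval h g xs"
    by blast
  have "eval h' (Comp f gs) xs = Some y"
    if h': "\<forall>q\<in>Q \<union> (\<Union>g\<in>set gs. R g). h' q = h q" for h'
  proof -
    have "map (\<lambda>g. eval h' g xs) gs = map Some vs"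
      unfolding vs[symmetric] using h' R(2) by (intro map_cong refl) blast
    then have "those (map (\<lambda>g. eval h' g xs) gs) = Some vs"
      by (simp only: those_eq_Some_iff)
    moreover have "eval h' f vs = Some y" using Q(2) h' by blast
    ultimately show ?thesis by (simp only: eval.simps Option.bind.simps)
  qed
  moreover have "finite (Q \<union> (\<Union>g\<in>set gs. R g))" using Q(1) R(1) by simp
  ultimately show ?case by blast
next
  case (PrimRec f g)
  from PrimRec.prems obtain n ys where xs: "xs = n # ys" by (auto split: list.splits)
  show ?case
    unfolding xs by (rule eval_rec_use[OF PrimRec.IH PrimRec.prems[unfolded xs]])
next
  case (Minim f)
  from Minim.prems have zero: "eval h f (y # xs) = Some 0"
    and pos: "\<forall>i<y. \<exists>v. eval h f (i # xs) = Some (Suc v)"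
    by (auto simp: minimize_eq_Some_iff)
  have "\<exists>R. finite R \<and> (\<forall>h'. (\<forall>q\<in>R. h' q = h q) \<longrightarrow>
      eval h' f (i # xs) = eval h f (i # xs))" if i: "i \<in> {..y}" for i
  proof -
    have "\<exists>v. eval h f (i # xs) = Some v"
      using zero pos i by (cases "i = y") (auto simp: le_less)
    then obtain v where v: "eval h f (i # xs) = Some v" ..
    show ?thesis using Minim.IH[OF v] unfolding v .
  qed
  then have "\<exists>R. \<forall>i\<in>{..y}. finite (R i) \<and>
      (\<forall>h'. (\<forall>q\<in>R i. h' q = h q) \<longrightarrow> eval h' f (i # xs) = eval h f (i # xs))"
    by (intro bchoice ballI)
  then obtain R where R: "\<And>i. i \<in> {..y} \<Longrightarrow> finite (R i)"
    "\<And>i h'. i \<in> {..y} \<Longrightarrow> \<forall>q\<in>R i. h' q = h q \<Longrightarrow> eval h' f (i # xs) = eval h f (i # xs)"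
    by blast
  have "eval h' (Minim f) xs = Some y" if h': "\<forall>q\<in>(\<Union>i\<le>y. R i). h' q = h q" for h'
  proof -
    have eq: "eval h' f (i # xs) = eval h f (i # xs)" if "i \<in> {..y}" for i
      using R(2)[OF that, of h'] h' that by blast
    have "eval h' f (y # xs) = Some 0" using eq[of y] zero by simp
    moreover have "\<forall>i<y. \<exists>v. eval h' f (i # xs) = Some (Suc v)"
    proof (intro allI impI)
      fix i assume "i < y"
      then show "\<exists>v. eval h' f (i # xs) = Some (Suc v)" using pos eq[of i] by simp
    qed
    ultimately show ?thesis by (simp only: eval.simps minimize_eq_Some_iff)
  qed
  moreover have "finite (\<Union>i\<le>y. R i)" using R(1) by simp
  ultimately show ?case by blast
qed

lemma eval_oracle_free:
  assumes "oracle_free p"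
  shows "eval h p xs = eval h' p xs"
  using assms
proof (induction p arbitrary: xs)
  case (Comp f gs)
  then have "map (\<lambda>g. eval h g xs) gs = map (\<lambda>g. eval h' g xs) gs"
    by (intro map_cong) auto
  moreover have "eval h f = eval h' f" using Comp by auto
  ultimately show ?case by (simp only: eval.simps)
next
  case (PrimRec f g)
  then have "eval h f = eval h' f" "eval h g = eval h' g" by auto
  then show ?case by (simp only: eval.simps)
next
  case (Minim f)
  then have "eval h f = eval h' f" by auto
  then show ?case by (simp only: eval.simps)
qed auto


section \<open>Coding of strings and rationals by natural numbers\<close>

text \<open>
  Every number codes a string: an entry of the coded list stands for the bit 1 iff it is
  nonzero.  So a string has many codes, one of them being
  \<open>list_encode (map of_bool \<sigma>)\<close>.
\<close>

definition string_decode :: "nat \<Rightarrow> bool list" where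
  "string_decode x = map (\<lambda>b. b \<noteq> 0) (list_decode x)"

definition rat_encode :: "rat \<Rightarrow> nat" where
  "rat_encode q = (case quotient_of q of (a, b) \<Rightarrow> prod_encode (int_encode a, nat b))"

lemma string_decode_list_encode: "string_decode (list_encode (map of_bool \<sigma>)) = \<sigma>"
  by (simp add: string_decode_def comp_def)

definition oracle_of :: "(bool list \<Rightarrow> nat \<Rightarrow> rat) \<Rightarrow> nat \<Rightarrow> nat" where
  "oracle_of f x = (case prod_decode x of (s, i) \<Rightarrow> rat_encode (f (string_decode s) i))"

text \<open>
  The domain of the modulus is \<open>\<nat> \<times> \<rat>\<^sub>>\<^sub>0\<close>; its values at \<open>\<epsilon> \<le> 0\<close> are not constrained.
\<close>

definition computable_modulus :: "(nat \<Rightarrow> rat \<Rightarrow> nat) \<Rightarrow> bool" where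
  "computable_modulus m \<longleftrightarrow>
    (\<exists>p. oracle_free p \<and>
      (\<forall>h j \<epsilon>. \<epsilon> > 0 \<longrightarrow> eval h p [j, rat_encode \<epsilon>] = Some (m j \<epsilon>)))"

definition computes_from :: "recfun \<Rightarrow> (bool list \<Rightarrow> nat \<Rightarrow> rat) \<Rightarrow> (nat \<Rightarrow> bool) \<Rightarrow> bool" where
  "computes_from p f \<omega> \<longleftrightarrow> (\<forall>k. eval (oracle_of f) p [k] = Some (of_bool (\<omega> k)))"


section \<open>Shift-invariant measures on Cantor space\<close>

text \<open>
  Cantor space is the type \<open>nat \<Rightarrow> bool\<close>; its library topology is the product of the
  discrete topologies on \<open>bool\<close>, and \<open>borel\<close> is the Borel \<open>\<sigma>\<close>-algebra of that topology.
\<close>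

definition cylinder :: "bool list \<Rightarrow> (nat \<Rightarrow> bool) set" where
  "cylinder \<sigma> = {\<omega>. \<forall>i<length \<sigma>. \<omega> i = \<sigma> ! i}"

definition shift :: "(nat \<Rightarrow> bool) \<Rightarrow> (nat \<Rightarrow> bool)" where
  "shift \<omega> = (\<lambda>k. \<omega> (k + 1))"

definition shift_invariant_prob :: "(nat \<Rightarrow> bool) measure \<Rightarrow> bool" where
  "shift_invariant_prob \<mu> \<longleftrightarrow>
    prob_space \<mu> \<and> sets \<mu> = sets borel \<and>
    (\<forall>B\<in>sets borel. measure \<mu> (shift -` B) = measure \<mu> B)"

definition is_representation :: "(nat \<Rightarrow> bool) measure \<Rightarrow> (bool list \<Rightarrow> nat \<Rightarrow> rat) \<Rightarrow> bool" where
  "is_representation \<mu> f \<longleftrightarrow>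
    (\<forall>\<sigma> i. \<bar>measure \<mu> (cylinder \<sigma>) - of_rat (f \<sigma> i)\<bar> < 1 / 2 ^ i)"

definition frequency :: "bool list \<Rightarrow> (nat \<Rightarrow> bool) \<Rightarrow> nat \<Rightarrow> real" where
  "frequency \<sigma> \<omega> n = 1 / real n * (\<Sum>i<n. indicator (cylinder \<sigma>) ((shift ^^ i) \<omega>))"

definition generic :: "(nat \<Rightarrow> bool) measure \<Rightarrow> (nat \<Rightarrow> bool) \<Rightarrow> bool" where
  "generic \<mu> \<omega> \<longleftrightarrow> (\<forall>\<sigma>. (\<lambda>n. frequency \<sigma> \<omega> n) \<longlonglongrightarrow> measure \<mu> (cylinder \<sigma>))"

end

theory Submission
  imports Defs
begin

text \<open>
  Fix \<open>L\<close>.  By invariance, \<open>\<mu>[\<sigma>]\<close> is the \<open>\<mu>\<close>-average over words \<open>u\<close> of length \<open>L\<close> of the frequency of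
  \<open>\<sigma>\<close> inside \<open>u\<close>, up to an error \<open>|\<sigma>| / L\<close> from occurrences that overlap the end of \<open>u\<close>.  Hence a
  concatenation of \<open>4^L\<close> words of length \<open>L\<close> in which each \<open>u\<close> occurs about \<open>4^L \<mu>[u]\<close> times, repeated
  periodically, has almost the right frequencies; the multiplicities are read off a rational
  approximation of \<open>\<mu>[u]\<close>.  The point follows this periodic sequence on positions \<open>k\<close> with
  \<open>2^(L^2) \<le> k < 2^((L + 1)^2)\<close>.  Stages before \<open>L - 1\<close> and the period length \<open>L 4^L\<close> are negligible
  compared with \<open>2^(L^2)\<close>, so the error at \<open>n\<close> is controlled by the number of its stage alone, whatever
  \<open>\<mu>\<close> is.
\<close>

section \<open>Total computable functionals\<close>

text \<open>One term has to serve all oracles \<open>h\<close>, so \<open>F\<close> takes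
  \<open>h\<close> as an argument. The flag \<open>pure\<close> demands an oracle-free term, so that
  the same closure rules serve both the modulus and the point.\<close>

definition computable :: "bool \<Rightarrow> nat \<Rightarrow> ((nat \<Rightarrow> nat) \<Rightarrow> nat list \<Rightarrow> nat) \<Rightarrow> bool" where
  "computable pure n F \<longleftrightarrow>
    (\<exists>p. (pure \<longrightarrow> oracle_free p) \<and> (\<forall>h xs. length xs = n \<longrightarrow> eval h p xs = Some (F h xs)))"

lemma computableI:
  assumes "pure \<Longrightarrow> oracle_free p"
    and "\<And>h xs. length xs = n \<Longrightarrow> eval h p xs = Some (F h xs)"
  shows "computable pure n F"
  using assms unfolding computable_def by blast

lemma computable_cong:
  assumes "computable pure n F" "\<And>h xs. length xs = n \<Longrightarrow> F h xs = G h xs"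
  shows "computable pure n G"
  using assms unfolding computable_def by metis

lemma computable_nth: "i < n \<Longrightarrow> computable pure n (\<lambda>h xs. xs ! i)"
  by (rule computableI[of _ "Proj i"]) auto

lemma computable_comp:
  assumes F: "computable pure (length Gs) F"
    and Gs: "\<And>G. G \<in> set Gs \<Longrightarrow> computable pure n G"
  shows "computable pure n (\<lambda>h xs. F h (map (\<lambda>G. G h xs) Gs))"
proof -
  obtain p where p: "pure \<longrightarrow> oracle_free p"
    "\<And>h xs. length xs = length Gs \<Longrightarrow> eval h p xs = Some (F h xs)"
    using F unfolding computable_def by blast
  have "\<exists>q. \<forall>G\<in>set Gs. (pure \<longrightarrow> oracle_free (q G)) \<and>
      (\<forall>h xs. length xs = n \<longrightarrow> eval h (q G) xs = Some (G h xs))"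
    using Gs unfolding computable_def by (intro bchoice) blast
  then obtain q where q: "\<And>G. G \<in> set Gs \<Longrightarrow> pure \<Longrightarrow> oracle_free (q G)"
    "\<And>G h xs. G \<in> set Gs \<Longrightarrow> length xs = n \<Longrightarrow> eval h (q G) xs = Some (G h xs)"
    by blast
  show ?thesis
  proof (rule computableI[of _ "Comp p (map q Gs)"])
    show "oracle_free (Comp p (map q Gs))" if pure
      using that p q by auto
    fix h and xs :: "nat list" assume "length xs = n"
    then have "map (\<lambda>g. eval h g xs) (map q Gs) = map Some (map (\<lambda>G. G h xs) Gs)"
      using q(2) by simp
    then have "those (map (\<lambda>g. eval h g xs) (map q Gs)) = Some (map (\<lambda>G. G h xs) Gs)"
      by (simp only: those_eq_Some_iff)
    then show "eval h (Comp p (map q Gs)) xs = Some (F h (map (\<lambda>G. G h xs) Gs))"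
      using p(2) by (simp only: eval.simps Option.bind.simps length_map)
  qed
qed

lemma computable_comp1:
  assumes "computable pure 1 (\<lambda>h ys. f h (ys ! 0))" "computable pure n G"
  shows "computable pure n (\<lambda>h xs. f h (G h xs))"
  using computable_comp[of pure "[G]" "\<lambda>h ys. f h (ys ! 0)" n] assms by simp

lemma computable_comp2:
  assumes "computable pure 2 (\<lambda>h ys. f h (ys ! 0) (ys ! 1))"
    "computable pure n G" "computable pure n H"
  shows "computable pure n (\<lambda>h xs. f h (G h xs) (H h xs))"
  using computable_comp[of pure "[G, H]" "\<lambda>h ys. f h (ys ! 0) (ys ! 1)" n] assms
  by (auto simp: numeral_2_eq_2)

text \<open>\<open>B\<close> is the step as a term sees it, with one list that has the counter and
  the previous value in front; \<open>C\<close> is its curried form, and \<open>eq\<close> links the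
  two.\<close>

lemma computable_rec:
  assumes A: "computable pure n A" and N: "computable pure n N"
    and B: "computable pure (Suc (Suc n)) B"
    and eq: "\<And>h k r xs. length xs = n \<Longrightarrow> B h (k # r # xs) = C h xs k r"
  shows "computable pure n (\<lambda>h xs. rec_nat (A h xs) (C h xs) (N h xs))"
proof -
  obtain p where p: "pure \<longrightarrow> oracle_free p"
    "\<And>h xs. length xs = n \<Longrightarrow> eval h p xs = Some (A h xs)"
    using A unfolding computable_def by blast
  obtain q where q: "pure \<longrightarrow> oracle_free q"
    "\<And>h xs. length xs = Suc (Suc n) \<Longrightarrow> eval h q xs = Some (B h xs)"
    using B unfolding computable_def by blast
  have "computable pure (Suc n) (\<lambda>h ys. rec_nat (A h (tl ys)) (C h (tl ys)) (hd ys))"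
  proof (rule computableI[of _ "PrimRec p q"])
    show "oracle_free (PrimRec p q)" if pure
      using that p q by auto
    fix h and ys :: "nat list" assume "length ys = Suc n"
    then obtain m xs where ys: "ys = m # xs" and xs: "length xs = n"
      by (auto simp: length_Suc_conv)
    have "eval h (PrimRec p q) (m # xs) = Some (rec_nat (A h xs) (C h xs) m)"
      by (induction m) (use xs eq p(2) q(2) in simp_all)
    then show "eval h (PrimRec p q) ys = Some (rec_nat (A h (tl ys)) (C h (tl ys)) (hd ys))"
      by (simp add: ys)
  qed
  \<comment> \<open>\<open>PrimRec\<close> takes its bound from the head of the list:
    \<open>N\<close> is put there, and the projections pass on all parameters.\<close>
  then have "computable pure n (\<lambda>h xs. (\<lambda>h ys. rec_nat (A h (tl ys)) (C h (tl ys)) (hd ys)) h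
      (map (\<lambda>G. G h xs) (N # map (\<lambda>i (h :: nat \<Rightarrow> nat) xs. xs ! i) [0..<n])))"
    by (intro computable_comp) (auto intro: N computable_nth)
  then show ?thesis
  proof (rule computable_cong)
    fix h and xs :: "nat list" assume "length xs = n"
    then have "map (\<lambda>G. G h xs) (map (\<lambda>i (h :: nat \<Rightarrow> nat) xs. xs ! i) [0..<n]) = xs"
      by (auto simp: comp_def map_nth)
    then show "(\<lambda>h ys. rec_nat (A h (tl ys)) (C h (tl ys)) (hd ys)) h
        (map (\<lambda>G. G h xs) (N # map (\<lambda>i (h :: nat \<Rightarrow> nat) xs. xs ! i) [0..<n])) =
        rec_nat (A h xs) (C h xs) (N h xs)"
      by simp
  qed
qed

text \<open>The predicate is presented as the zero set of \<open>F\<close>. Below the least witness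
  \<open>F\<close> is a successor, as \<open>minimize\<close> demands, and \<open>ex\<close> makes
  the search total.\<close>

lemma computable_Least:
  assumes F: "computable pure (Suc n) F"
    and eq: "\<And>h xs y. length xs = n \<Longrightarrow> F h (y # xs) = 0 \<longleftrightarrow> P h xs y"
    and ex: "\<And>h xs. length xs = n \<Longrightarrow> \<exists>y. P h xs y"
  shows "computable pure n (\<lambda>h xs. LEAST y. P h xs y)"
proof -
  obtain p where p: "pure \<longrightarrow> oracle_free p"
    "\<And>h xs. length xs = Suc n \<Longrightarrow> eval h p xs = Some (F h xs)"
    using F unfolding computable_def by blast
  show ?thesis
  proof (rule computableI[of _ "Minim p"])
    show "oracle_free (Minim p)" if pure
      using that p by auto
    fix h and xs :: "nat list" assume xs: "length xs = n"
    obtain y where y: "P h xs y" using ex[OF xs] by blast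
    have "P h xs (LEAST y. P h xs y)" using y by (rule LeastI)
    moreover have "\<exists>z. F h (i # xs) = Suc z" if "i < (LEAST y. P h xs y)" for i
      using not_less_Least[OF that] eq[OF xs] by (metis not0_implies_Suc)
    ultimately show "eval h (Minim p) xs = Some (LEAST y. P h xs y)"
      using xs eq[OF xs] p(2) by (simp add: minimize_eq_Some_iff)
  qed
qed

section \<open>Closure under the oracle and arithmetic operations\<close>

lemma computable_oracle:
  assumes "computable False n G"
  shows "computable False n (\<lambda>h xs. h (G h xs))"
proof (rule computable_comp1[OF _ assms])
  show "computable False 1 (\<lambda>h ys. h (ys ! 0))"
    by (rule computableI[of _ Oracle]) (auto simp: length_Suc_conv)
qed

lemma computable_Suc:
  assumes "computable pure n G"
  shows "computable pure n (\<lambda>h xs. Suc (G h xs))"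
proof (rule computable_comp1[OF _ assms])
  show "computable pure 1 (\<lambda>h ys. Suc (ys ! 0))"
    by (rule computableI[of _ Succ]) (auto simp: length_Suc_conv)
qed

lemma computable_const: "computable pure n (\<lambda>h xs. c)"
proof (induction c)
  case 0
  show ?case by (rule computableI[of _ Zero]) auto
qed (rule computable_Suc)

lemma computable_add:
  assumes "computable pure n G" "computable pure n H"
  shows "computable pure n (\<lambda>h xs. G h xs + H h xs)"
proof -
  have "rec_nat x (\<lambda>k r. Suc r) y = x + y" for x y :: nat
    by (induction y) auto
  then show ?thesis
    using computable_rec[OF assms, of "\<lambda>h ys. Suc (ys ! 1)" "\<lambda>h xs k r. Suc r"]
    by (simp add: computable_Suc computable_nth)
qed

lemma computable_mult:
  assumes "computable pure n G" "computable pure n H"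
  shows "computable pure n (\<lambda>h xs. G h xs * H h xs)"
proof (rule computable_comp2[OF _ assms])
  have "rec_nat 0 (\<lambda>k r. r + x) y = x * y" for x y :: nat
    by (induction y) auto
  then show "computable pure 2 (\<lambda>h ys. ys ! 0 * ys ! 1)"
    using computable_rec[OF computable_const computable_nth, of 1 2 pure
        "\<lambda>h ys. ys ! 1 + ys ! 2" "\<lambda>h xs k r. r + xs ! 0" 0]
    by (simp add: computable_add computable_nth)
qed

lemma computable_power:
  assumes "computable pure n G" "computable pure n H"
  shows "computable pure n (\<lambda>h xs. G h xs ^ H h xs)"
proof (rule computable_comp2[OF _ assms])
  have "rec_nat 1 (\<lambda>k r. r * x) y = x ^ y" for x y :: nat
    by (induction y) auto
  then show "computable pure 2 (\<lambda>h ys. ys ! 0 ^ ys ! 1)"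
    using computable_rec[OF computable_const computable_nth, of 1 2 pure
        "\<lambda>h ys. ys ! 1 * ys ! 2" "\<lambda>h xs k r. r * xs ! 0" 1]
    by (simp add: computable_mult computable_nth)
qed

lemma computable_diff:
  assumes "computable pure n G" "computable pure n H"
  shows "computable pure n (\<lambda>h xs. G h xs - H h xs)"
proof -
  \<comment> \<open>The predecessor is a recursion that returns its counter; iterating it gives
    truncated subtraction.\<close>
  have "rec_nat 0 (\<lambda>k r. k) x = x - 1" for x :: nat
    by (cases x) auto
  then have pred: "computable pure n (\<lambda>h xs. G h xs - 1)" if "computable pure n G" for n G
    using computable_rec[OF computable_const that, of "\<lambda>h ys. ys ! 0" "\<lambda>h xs k r. k" 0]
    by (simp add: computable_nth)
  have "rec_nat x (\<lambda>k r. r - 1) y = x - y" for x y :: nat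
    by (induction y) auto
  then show ?thesis
    using computable_rec[OF assms, of "\<lambda>h ys. ys ! 1 - 1" "\<lambda>h xs k r. r - 1"]
      pred[OF computable_nth, of 1 "Suc (Suc n)"]
    by simp
qed

lemma computable_if_0:
  assumes "computable pure n P" "computable pure n G" "computable pure n H"
  shows "computable pure n (\<lambda>h xs. if P h xs = 0 then G h xs else H h xs)"
proof -
  \<comment> \<open>With truncated subtraction, \<open>1 - P\<close> is 1 if \<open>P\<close> is 0
    and 0 otherwise, so the two products select a branch.\<close>
  have "computable pure n (\<lambda>h xs. (1 - P h xs) * G h xs + (1 - (1 - P h xs)) * H h xs)"
    by (intro computable_add computable_mult computable_diff computable_const assms)
  then show ?thesis by (rule computable_cong) auto
qed

lemma div_eq_Least:
  assumes "y > 0"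
  shows "(x :: nat) div y = (LEAST q. x < Suc q * y)"
proof (rule Least_equality[symmetric])
  show "x < Suc (x div y) * y"
    using assms by (simp add: dividend_less_div_times)
  show "x div y \<le> q" if "x < Suc q * y" for q
    using less_mult_imp_div_less[OF that] by simp
qed

lemma computable_div:
  assumes "computable pure n G" "computable pure n H"
  shows "computable pure n (\<lambda>h xs. G h xs div H h xs)"
proof (rule computable_comp2[OF _ assms])
  \<comment> \<open>The first disjunct stops the search at 0 when the divisor is 0, in agreement
    with \<open>x div 0 = 0\<close>.\<close>
  have "computable pure 2 (\<lambda>h xs. LEAST q. xs ! 1 = 0 \<or> xs ! 0 < Suc q * xs ! 1)"
  proof (rule computable_Least)
    show "computable pure (Suc 2)
        (\<lambda>h ys. if ys ! 2 = 0 then 0 else Suc (ys ! 1) - Suc (ys ! 0) * ys ! 2)"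
      by (intro computable_if_0 computable_diff computable_mult computable_Suc computable_nth
          computable_const) auto
    show "\<exists>q. xs ! 1 = 0 \<or> xs ! 0 < Suc q * xs ! 1" for xs :: "nat list"
      by (intro exI[of _ "xs ! 0"]) (cases "xs ! 1"; auto)
  qed auto
  then show "computable pure 2 (\<lambda>h ys. ys ! 0 div ys ! 1)"
  proof (rule computable_cong)
    show "(LEAST q. xs ! 1 = 0 \<or> xs ! 0 < Suc q * xs ! 1) = xs ! 0 div xs ! 1" for xs :: "nat list"
    proof (cases "xs ! 1 = 0")
      case True
      then show ?thesis by (auto intro: Least_equality)
    next
      case False
      then show ?thesis by (simp add: div_eq_Least del: mult_Suc)
    qed
  qed
qed

lemma computable_mod:
  assumes "computable pure n G" "computable pure n H"
  shows "computable pure n (\<lambda>h xs. G h xs mod H h xs)"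
proof -
  have "computable pure n (\<lambda>h xs. G h xs - G h xs div H h xs * H h xs)"
    by (intro computable_diff computable_mult computable_div assms)
  then show ?thesis by (rule computable_cong) (simp add: modulo_nat_def)
qed

section \<open>The pairing function and its inverses\<close>

lemma computable_triangle:
  assumes "computable pure n G"
  shows "computable pure n (\<lambda>h xs. triangle (G h xs))"
  unfolding triangle_def
  by (intro computable_div computable_mult computable_Suc computable_const assms)

lemma computable_prod_encode:
  assumes "computable pure n G" "computable pure n H"
  shows "computable pure n (\<lambda>h xs. prod_encode (G h xs, H h xs))"
  unfolding prod_encode_def
  by (simp, intro computable_add computable_triangle assms)

lemma triangle_mono: "m \<le> n \<Longrightarrow> triangle m \<le> triangle n"
  by (induction n rule: dec_induct) auto

text \<open>\<open>prod_encode\<close> runs along diagonals: the codes of pairs with sum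
  \<open>s\<close> fill the interval from \<open>triangle s\<close> to
  \<open>triangle (Suc s) - 1\<close>. A search for the diagonal therefore decodes the pair.\<close>

lemma prod_encode_sum_eq_Least: "a + b = (LEAST w. prod_encode (a, b) < triangle (Suc w))"
proof (rule Least_equality[symmetric])
  show "a + b \<le> w" if "prod_encode (a, b) < triangle (Suc w)" for w
    using that triangle_mono[of "Suc w" "a + b"]
    by (cases "a + b \<le> w") (simp_all add: prod_encode_def del: triangle_Suc)
qed (auto simp: prod_encode_def)

lemma computable_prod_decode:
  assumes "computable pure n G"
  shows computable_fst_prod_decode: "computable pure n (\<lambda>h xs. fst (prod_decode (G h xs)))"
    and computable_snd_prod_decode: "computable pure n (\<lambda>h xs. snd (prod_decode (G h xs)))"
proof -
  define w where "w x = (LEAST w. x < triangle (Suc w))" for x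
  have w: "computable pure n (\<lambda>h xs. w (G h xs))" if "computable pure n G" for n G
  proof (rule computable_comp1[OF _ that])
    show "computable pure 1 (\<lambda>h ys. w (ys ! 0))"
      unfolding w_def
    proof (rule computable_Least)
      show "computable pure (Suc 1) (\<lambda>h ys. Suc (ys ! 1) - triangle (Suc (ys ! 0)))"
        by (intro computable_diff computable_triangle computable_Suc computable_nth) auto
      show "\<exists>w. xs ! 0 < triangle (Suc w)" for xs :: "nat list"
        by (intro exI[of _ "xs ! 0"]) auto
    qed auto
  qed
  have w_eq: "w (prod_encode (a, b)) = a + b" for a b
    by (simp only: w_def prod_encode_sum_eq_Least)
  have decode: "prod_decode x = (x - triangle (w x), w x - (x - triangle (w x)))" for x
  proof -
    obtain a b where "x = prod_encode (a, b)"
      by (cases "prod_decode x") (metis prod_decode_inverse)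
    then show ?thesis by (simp add: w_eq) (simp add: prod_encode_def)
  qed
  show "computable pure n (\<lambda>h xs. fst (prod_decode (G h xs)))"
    unfolding decode fst_conv by (intro computable_diff computable_triangle w assms)
  show "computable pure n (\<lambda>h xs. snd (prod_decode (G h xs)))"
    unfolding decode snd_conv by (intro computable_diff computable_triangle w assms)
qed

lemmas computable_intros =
  computable_nth computable_const computable_Suc computable_add computable_mult computable_power
  computable_diff computable_if_0 computable_div computable_mod computable_prod_encode
  computable_fst_prod_decode computable_snd_prod_decode

section \<open>The point and its computability\<close>

text \<open>The binary expansion of \<open>x\<close> with \<open>L\<close> digits, most significant
  first; hence the index \<open>L - 1 - i\<close> in later formulas. The numbers below
  \<open>2 ^ L\<close> enumerate the words of length \<open>L\<close>.\<close>

primrec word :: "nat \<Rightarrow> nat \<Rightarrow> bool list" where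
  "word 0 x = []"
| "word (Suc L) x = bit x L # word L x"

lemma length_word [simp]: "length (word L x) = L"
  by (induction L) auto

lemma nth_word: "i < L \<Longrightarrow> word L x ! i = bit x (L - 1 - i)"
  by (induction L arbitrary: i) (auto simp: nth_Cons split: nat.splits)

text \<open>
  An even value of \<open>int_encode\<close> is the code of a nonnegative integer.  Subtracting 1 compensates the
  error of the approximation, so that the multiplicities never exceed \<open>4^L \<mu>[u]\<close> and add up to at
  most \<open>4^L\<close>; the last word takes the blocks that are left over (the second disjunct in \<open>quantile\<close>).
\<close>

definition block_count :: "(nat \<Rightarrow> nat) \<Rightarrow> nat \<Rightarrow> nat \<Rightarrow> nat" where
  "block_count h L x =
    (case prod_decode (h (prod_encode (list_encode (map of_bool (word L x)), 2 * L))) of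
      (a, b) \<Rightarrow> (if even a then 4 ^ L * (a div 2) div b else 0) - 1)"

definition quantile :: "(nat \<Rightarrow> nat) \<Rightarrow> nat \<Rightarrow> nat \<Rightarrow> nat" where
  "quantile c M b = (LEAST x. b < (\<Sum>y<Suc x. c y) \<or> M \<le> Suc x)"

text \<open>\<open>k div L mod 4 ^ L\<close> is the number of the block within the period and
  \<open>k mod L\<close> the position within the block. Blocks that carry the same word are
  consecutive, because \<open>quantile\<close> inverts the partial sums of the
  multiplicities.\<close>

definition stage_seq :: "(nat \<Rightarrow> nat) \<Rightarrow> nat \<Rightarrow> nat \<Rightarrow> bool" where
  "stage_seq h L k =
    bit (quantile (block_count h L) (2 ^ L) (k div L mod 4 ^ L)) (L - 1 - k mod L)"

definition stage :: "nat \<Rightarrow> nat" where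
  "stage k = (LEAST L. k < 2 ^ (Suc L)\<^sup>2)"

definition point :: "(nat \<Rightarrow> nat) \<Rightarrow> nat \<Rightarrow> bool" where
  "point h k = stage_seq h (stage k) k"

lemma of_bool_bit: "(of_bool (bit x n) :: nat) = x div 2 ^ n mod 2" for x :: nat
  by (simp add: bit_iff_odd mod_2_eq_odd)

text \<open>\<open>word\<close> prepends bit \<open>k\<close> at step \<open>k\<close>, and
  \<open>list_encode\<close> turns a cons into \<open>Suc\<close> of a pair, so the code is built by
  primitive recursion on the length.\<close>

lemma computable_word_code:
  assumes "computable pure n F" "computable pure n G"
  shows "computable pure n (\<lambda>h xs. list_encode (map of_bool (word (F h xs) (G h xs))))"
proof -
  have "list_encode (map of_bool (word L x)) =
      rec_nat 0 (\<lambda>k r. Suc (prod_encode (x div 2 ^ k mod 2, r))) L" for L x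
    by (induction L) (simp_all add: of_bool_bit)
  moreover have "computable pure 2
      (\<lambda>h xs. rec_nat 0 (\<lambda>k r. Suc (prod_encode (xs ! 1 div 2 ^ k mod 2, r))) (xs ! 0))"
    by (rule computable_rec[where
          B = "\<lambda>h ys. Suc (prod_encode (ys ! 3 div 2 ^ (ys ! 0) mod 2, ys ! 1))"])
      (auto intro!: computable_intros)
  ultimately have "computable pure 2 (\<lambda>h xs. list_encode (map of_bool (word (xs ! 0) (xs ! 1))))"
    by simp
  from computable_comp2[OF this assms] show ?thesis .
qed

lemma computable_block_count:
  assumes "computable False n F" "computable False n G"
  shows "computable False n (\<lambda>h xs. block_count h (F h xs) (G h xs))"
proof (rule computable_comp2[OF _ assms])
  define q where "q h ys = h (prod_encode
    (list_encode (map of_bool (word (ys ! 0) (ys ! 1))), 2 * ys ! 0))"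
    for h :: "nat \<Rightarrow> nat" and ys :: "nat list"
  have q: "computable False 2 q"
    unfolding q_def by (intro computable_oracle computable_word_code computable_intros) auto
  have "computable False 2 (\<lambda>h ys. (if fst (prod_decode (q h ys)) mod 2 = 0
      then 4 ^ (ys ! 0) * (fst (prod_decode (q h ys)) div 2) div snd (prod_decode (q h ys))
      else 0) - 1)"
    by (intro computable_intros q) auto
  then show "computable False 2 (\<lambda>h ys. block_count h (ys ! 0) (ys ! 1))"
    by (rule computable_cong)
      (simp only: block_count_def q_def case_prod_beta even_iff_mod_2_eq_zero)
qed

lemma computable_sum_block_count:
  assumes "computable False n F" "computable False n G"
  shows "computable False n (\<lambda>h xs. \<Sum>y<G h xs. block_count h (F h xs) y)"
proof (rule computable_comp2[OF _ assms])
  have "(\<Sum>y<m. c y) = rec_nat 0 (\<lambda>k r. r + c k) m" for m and c :: "nat \<Rightarrow> nat"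
    by (induction m) auto
  moreover have "computable False 2
      (\<lambda>h xs. rec_nat 0 (\<lambda>k r. r + block_count h (xs ! 0) k) (xs ! 1))"
    by (rule computable_rec[where B = "\<lambda>h ys. ys ! 1 + block_count h (ys ! 2) (ys ! 0)"])
      (auto intro!: computable_intros computable_block_count)
  ultimately show "computable False 2 (\<lambda>h ys. \<Sum>y<ys ! 1. block_count h (ys ! 0) y)"
    by simp
qed

lemma computable_quantile_block_count:
  assumes "computable False n F" "computable False n G"
  shows "computable False n (\<lambda>h xs. quantile (block_count h (F h xs)) (2 ^ F h xs) (G h xs))"
proof (rule computable_comp2[OF _ assms])
  show "computable False 2 (\<lambda>h ys. quantile (block_count h (ys ! 0)) (2 ^ (ys ! 0)) (ys ! 1))"
    unfolding quantile_def
  proof (rule computable_Least)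
    \<comment> \<open>A product vanishes iff one of its factors does, which encodes the disjunction;
      each truncated difference vanishes iff its inequality holds.\<close>
    show "computable False (Suc 2) (\<lambda>h ys.
        (Suc (ys ! 2) - (\<Sum>y<Suc (ys ! 0). block_count h (ys ! 1) y)) *
        (2 ^ (ys ! 1) - Suc (ys ! 0)))"
      by (intro computable_intros computable_sum_block_count) auto
    show "\<exists>x. xs ! 1 < (\<Sum>y<Suc x. block_count h (xs ! 0) y) \<or> 2 ^ (xs ! 0) \<le> Suc x"
      for h and xs :: "nat list"
      by (intro exI[of _ "2 ^ (xs ! 0)"]) simp
  qed (auto simp: Suc_le_eq simp del: sum.lessThan_Suc)
qed

section \<open>Stages and the computability of the point\<close>

lemma less_two_power_square: "k < 2 ^ (Suc k)\<^sup>2"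
proof -
  have "k < 2 ^ k" by (rule less_exp)
  also have "(2 :: nat) ^ k \<le> 2 ^ (Suc k)\<^sup>2"
    by (rule power_increasing) (auto simp: power2_eq_square)
  finally show ?thesis .
qed

lemma computable_stage:
  assumes "computable pure n F"
  shows "computable pure n (\<lambda>h xs. stage (F h xs))"
proof (rule computable_comp1[OF _ assms])
  show "computable pure 1 (\<lambda>h ys. stage (ys ! 0))"
    unfolding stage_def
  proof (rule computable_Least)
    show "computable pure (Suc 1) (\<lambda>h ys. Suc (ys ! 1) - 2 ^ (Suc (ys ! 0))\<^sup>2)"
      by (intro computable_intros) auto
    show "\<exists>L. xs ! 0 < 2 ^ (Suc L)\<^sup>2" for xs :: "nat list"
      using less_two_power_square by blast
  qed auto
qed

lemma computable_point:
  assumes "computable False n F"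
  shows "computable False n (\<lambda>h xs. of_bool (point h (F h xs)))"
  unfolding point_def stage_seq_def of_bool_bit
  by (intro computable_intros computable_quantile_block_count computable_stage assms)

lemma stage_eqI:
  assumes "2 ^ L\<^sup>2 \<le> k" "k < 2 ^ (Suc L)\<^sup>2"
  shows "stage k = L"
  unfolding stage_def
proof (rule Least_equality)
  show "L \<le> M" if "k < 2 ^ (Suc M)\<^sup>2" for M
  proof (rule ccontr)
    assume "\<not> L \<le> M"
    then have "(Suc M)\<^sup>2 \<le> L\<^sup>2" by (intro power_mono) auto
    then have "(2 :: nat) ^ (Suc M)\<^sup>2 \<le> 2 ^ L\<^sup>2" by (intro power_increasing) auto
    with that assms show False by simp
  qed
qed fact

text \<open>By minimality \<open>k\<close> lies beyond the preceding stage. Stage 0 has none, and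
  there the lower bound reads \<open>1 \<le> k\<close>, which is supplied by the assumption.\<close>

lemma stage_bounds:
  assumes "k \<ge> 2"
  shows "2 ^ (stage k)\<^sup>2 \<le> k" "k < 2 ^ (Suc (stage k))\<^sup>2"
proof -
  show "k < 2 ^ (Suc (stage k))\<^sup>2"
    unfolding stage_def by (rule LeastI) (rule less_two_power_square)
  show "2 ^ (stage k)\<^sup>2 \<le> k"
  proof (cases "stage k")
    case 0
    then show ?thesis using assms by simp
  next
    case (Suc M)
    then have "\<not> k < 2 ^ (Suc M)\<^sup>2"
      using not_less_Least[of M "\<lambda>L. k < 2 ^ (Suc L)\<^sup>2"] by (simp add: stage_def)
    with Suc show ?thesis by simp
  qed
qed

lemma stage_mono:
  assumes "2 ^ L\<^sup>2 \<le> k"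
  shows "L \<le> stage k"
proof -
  have "k < 2 ^ (Suc (stage k))\<^sup>2"
    unfolding stage_def by (rule LeastI) (rule less_two_power_square)
  with assms have "(2 :: nat) ^ L\<^sup>2 < 2 ^ (Suc (stage k))\<^sup>2" by (rule le_less_trans)
  then have "L\<^sup>2 < (Suc (stage k))\<^sup>2" by (rule power_less_imp_less_exp[rotated]) simp
  then show ?thesis using power2_less_imp_less[of L "Suc (stage k)"] by simp
qed

section \<open>Multiplicities of words\<close>

text \<open>The block numbers between two consecutive partial sums belong to the word
  \<open>x\<close>: partial sums are monotone, so no smaller number passes the test of the
  search.\<close>

lemma quantile_eqI:
  assumes "(\<Sum>y<x. c y) \<le> b" "b < (\<Sum>y<Suc x. c y)" "x < M"
  shows "quantile c M b = x"
  unfolding quantile_def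
proof (rule Least_equality)
  fix z assume z: "b < (\<Sum>y<Suc z. c y) \<or> M \<le> Suc z"
  show "x \<le> z"
  proof (rule ccontr)
    assume "\<not> x \<le> z"
    then have "(\<Sum>y<Suc z. c y) \<le> (\<Sum>y<x. c y)"
      by (intro sum_mono2) auto
    with z assms \<open>\<not> x \<le> z\<close> show False by linarith
  qed
qed (use assms in blast)

text \<open>Word \<open>X\<close> occupies an interval of \<open>c X\<close> block numbers just
  after those of the smaller words; the induction appends one interval at a time.\<close>

lemma sum_quantile:
  fixes \<phi> :: "nat \<Rightarrow> real"
  assumes "X \<le> M"
  shows "(\<Sum>b<(\<Sum>y<X. c y). \<phi> (quantile c M b)) = (\<Sum>x<X. real (c x) * \<phi> x)"
  using assms
proof (induction X)
  case (Suc X)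
  let ?s = "\<Sum>y<X. c y"
  have "(\<Sum>b<?s + c X. \<phi> (quantile c M b)) =
      (\<Sum>b<?s. \<phi> (quantile c M b)) + (\<Sum>b=?s..<?s + c X. \<phi> (quantile c M b))"
    by (simp add: lessThan_atLeast0 sum.atLeastLessThan_concat)
  also have "(\<Sum>b=?s..<?s + c X. \<phi> (quantile c M b)) = (\<Sum>b=?s..<?s + c X. \<phi> X)"
    using Suc.prems by (intro sum.cong refl arg_cong[where f = \<phi>] quantile_eqI) auto
  finally show ?case using Suc by simp
qed simp

text \<open>The multiplicities fall short of the weights by at most \<open>\<delta>\<close> each, so
  at most \<open>\<delta> * M\<close> blocks are left over. The shortfall lowers the sum and the
  leftover blocks raise it; since the two errors have opposite signs, they do not add up.\<close>

lemma sum_quantile_approx: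
  fixes p \<phi> :: "nat \<Rightarrow> real"
  assumes c: "\<And>x. x < M \<Longrightarrow> real (c x) \<le> real K * p x"
      "\<And>x. x < M \<Longrightarrow> real K * p x \<le> real (c x) + \<delta>"
    and p: "(\<Sum>x<M. p x) = 1"
    and \<phi>: "\<And>x. 0 \<le> \<phi> x" "\<And>x. \<phi> x \<le> 1"
  shows "\<bar>(\<Sum>b<K. \<phi> (quantile c M b)) - K * (\<Sum>x<M. p x * \<phi> x)\<bar> \<le> \<delta> * M"
proof -
  let ?S = "\<Sum>y<M. c y"
  have Kp: "real K = (\<Sum>x<M. real K * p x)"
    by (simp add: p flip: sum_distrib_left)
  have "real ?S \<le> (\<Sum>x<M. real K * p x)"
    unfolding of_nat_sum by (intro sum_mono c(1)) auto
  then have SK: "?S \<le> K" using Kp by linarith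
  have "real K \<le> (\<Sum>x<M. real (c x) + \<delta>)"
    by (subst Kp) (intro sum_mono c(2), auto)
  then have KS: "real K - real ?S \<le> \<delta> * M"
    by (simp add: sum.distrib mult.commute)
  have "(\<Sum>b<K. \<phi> (quantile c M b)) =
      (\<Sum>b<?S. \<phi> (quantile c M b)) + (\<Sum>b=?S..<K. \<phi> (quantile c M b))"
    using SK by (simp add: lessThan_atLeast0 sum.atLeastLessThan_concat)
  also have "(\<Sum>b<?S. \<phi> (quantile c M b)) = (\<Sum>x<M. real (c x) * \<phi> x)"
    by (rule sum_quantile) simp
  finally have eq: "(\<Sum>b<K. \<phi> (quantile c M b)) =
      (\<Sum>x<M. real (c x) * \<phi> x) + (\<Sum>b=?S..<K. \<phi> (quantile c M b))" .
  have "(\<Sum>b=?S..<K. \<phi> (quantile c M b)) \<le> (\<Sum>b=?S..<K. 1)"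
    by (intro sum_mono \<phi>)
  then have rest: "(\<Sum>b=?S..<K. \<phi> (quantile c M b)) \<le> real K - real ?S"
    using SK by (simp add: of_nat_diff)
  have rest0: "0 \<le> (\<Sum>b=?S..<K. \<phi> (quantile c M b))"
    by (intro sum_nonneg \<phi>)
  have up: "(\<Sum>x<M. real (c x) * \<phi> x) \<le> K * (\<Sum>x<M. p x * \<phi> x)"
    unfolding sum_distrib_left mult.assoc[symmetric]
    by (intro sum_mono mult_right_mono c(1) \<phi>) auto
  have "K * (\<Sum>x<M. p x * \<phi> x) - (\<Sum>x<M. real (c x) * \<phi> x) =
      (\<Sum>x<M. (K * p x - real (c x)) * \<phi> x)"
    by (simp add: sum_distrib_left sum_subtractf algebra_simps)
  also have "\<dots> \<le> (\<Sum>x<M. \<delta> * 1)"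
  proof (intro sum_mono)
    fix x assume "x \<in> {..<M}"
    then have "0 \<le> K * p x - real (c x)" "K * p x - real (c x) \<le> \<delta>"
      using c[of x] by auto
    then show "(K * p x - real (c x)) * \<phi> x \<le> \<delta> * 1"
      by (intro mult_mono \<phi>) auto
  qed
  finally have "K * (\<Sum>x<M. p x * \<phi> x) - (\<Sum>x<M. real (c x) * \<phi> x) \<le> \<delta> * M"
    by (simp add: mult.commute)
  with eq rest rest0 up KS show ?thesis by (simp add: abs_le_iff)
qed

section \<open>Multiplicities read off a representation\<close>

lemma rat_decode:
  assumes "quotient_of q = (a, b)"
  shows "b > 0" "real_of_rat q = of_int a / of_int b"
    "prod_decode (rat_encode q) = (int_encode a, nat b)"
  using assms quotient_of_denom_pos[OF assms] quotient_of_div[OF assms]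
  by (auto simp: rat_encode_def of_rat_divide)

text \<open>\<open>int_encode\<close> doubles a nonnegative numerator, so halving recovers it and
  \<open>div\<close> takes the floor. A negative approximation has an odd code and yields 0, as does
  \<open>nat\<close> of a negative floor.\<close>

lemma block_count_oracle_of:
  "block_count (oracle_of f) L x = nat \<lfloor>4 ^ L * real_of_rat (f (word L x) (2 * L))\<rfloor> - 1"
proof -
  let ?q = "f (word L x) (2 * L)"
  obtain a b where ab: "quotient_of ?q = (a, b)" by (cases "quotient_of ?q")
  note d = rat_decode[OF ab]
  have "oracle_of f (prod_encode (list_encode (map of_bool (word L x)), 2 * L)) = rat_encode ?q"
    by (simp add: oracle_of_def string_decode_list_encode)
  then have "block_count (oracle_of f) L x =
      (if even (int_encode a) then 4 ^ L * (int_encode a div 2) div nat b else 0) - 1"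
    by (simp add: block_count_def d)
  also have "(if even (int_encode a) then 4 ^ L * (int_encode a div 2) div nat b else 0) =
      nat \<lfloor>4 ^ L * real_of_rat ?q\<rfloor>"
  proof (cases "a \<ge> 0")
    case True
    have "\<lfloor>4 ^ L * real_of_rat ?q\<rfloor> = \<lfloor>real_of_int (4 ^ L * a) / real_of_int b\<rfloor>"
      by (simp add: d)
    also have "\<dots> = 4 ^ L * a div b" by (rule floor_divide_of_int_eq)
    finally show ?thesis using True d(1)
      by (simp add: int_encode_def sum_encode_def nat_div_distrib nat_mult_distrib nat_power_eq)
  next
    case False
    then have "4 ^ L * real_of_rat ?q \<le> 0"
      using d(1) by (simp add: d mult_nonneg_nonpos divide_nonpos_pos)
    then show ?thesis using False by (simp add: int_encode_def sum_encode_def floor_le_iff)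
  qed
  finally show ?thesis .
qed

text \<open>Precision \<open>2 * L\<close> makes the error less than 1 after scaling by
  \<open>4 ^ L\<close>. That error, the floor and the subtraction of 1 account for one unit each in
  the constant 3.\<close>

lemma block_count_bounds:
  assumes "is_representation \<mu> f"
  shows "real (block_count (oracle_of f) L x) \<le> 4 ^ L * measure \<mu> (cylinder (word L x))"
    and "4 ^ L * measure \<mu> (cylinder (word L x)) \<le> real (block_count (oracle_of f) L x) + 3"
proof -
  define m where "m = measure \<mu> (cylinder (word L x))"
  define q where "q = real_of_rat (f (word L x) (2 * L))"
  have "\<bar>m - q\<bar> < 1 / 4 ^ L"
    using assms[unfolded is_representation_def, rule_format, of "word L x" "2 * L"]
    by (simp add: m_def q_def power_mult)
  then have "4 ^ L * \<bar>m - q\<bar> < 1" by (simp add: field_simps)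
  then have "\<bar>4 ^ L * m - 4 ^ L * q\<bar> < 1"
    by (simp add: abs_mult flip: right_diff_distrib)
  \<comment> \<open>This covers the case in which the subtraction is truncated at 0.\<close>
  moreover have "0 \<le> 4 ^ L * m" by (simp add: m_def)
  ultimately have "real (nat \<lfloor>4 ^ L * q\<rfloor> - 1) \<le> 4 ^ L * m"
    and "4 ^ L * m \<le> real (nat \<lfloor>4 ^ L * q\<rfloor> - 1) + 3"
    by linarith+
  then show "real (block_count (oracle_of f) L x) \<le> 4 ^ L * measure \<mu> (cylinder (word L x))"
    and "4 ^ L * measure \<mu> (cylinder (word L x)) \<le> real (block_count (oracle_of f) L x) + 3"
    by (simp_all add: block_count_oracle_of m_def q_def)
qed

section \<open>Occurrences of strings and the measure of cylinders\<close>

lemma shift_funpow: "(shift ^^ r) \<omega> = (\<lambda>k. \<omega> (k + r))"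
  by (induction r arbitrary: \<omega>) (auto simp: shift_def funpow_swap1)

text \<open>Stated for any bit sequence, so that it applies to points of the space, to
  \<open>stage_seq\<close> and to the bits of a number alike.\<close>

definition match :: "bool list \<Rightarrow> (nat \<Rightarrow> bool) \<Rightarrow> nat \<Rightarrow> bool" where
  "match \<sigma> \<omega> i \<longleftrightarrow> (\<forall>l<length \<sigma>. \<omega> (i + l) = \<sigma> ! l)"

lemma shift_funpow_mem_cylinder: "(shift ^^ r) \<omega> \<in> cylinder \<sigma> \<longleftrightarrow> match \<sigma> \<omega> r"
  by (simp add: shift_funpow cylinder_def match_def add.commute)

lemma frequency_eq: "frequency \<sigma> \<omega> n = (\<Sum>i<n. of_bool (match \<sigma> \<omega> i)) / n"
  by (simp add: frequency_def indicator_def shift_funpow_mem_cylinder)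

text \<open>Finitely many coordinates are prescribed, and each coordinate map into the discrete
  space \<open>bool\<close> is continuous.\<close>

lemma borel_match: "{\<omega>. match \<sigma> \<omega> r} \<in> sets borel"
proof -
  have "open ((\<lambda>\<omega> :: nat \<Rightarrow> bool. \<omega> k) -` {b})" for k b
    by (intro open_vimage Topological_Spaces.open_discrete continuous_on_product_coordinates)
  then have "open {\<omega> :: nat \<Rightarrow> bool. \<omega> k = b}" for k b
    by (simp add: vimage_def)
  then have "open (\<Inter>l<length \<sigma>. {\<omega> :: nat \<Rightarrow> bool. \<omega> (r + l) = \<sigma> ! l})"
    by (intro open_INT) auto
  also have "(\<Inter>l<length \<sigma>. {\<omega> :: nat \<Rightarrow> bool. \<omega> (r + l) = \<sigma> ! l}) = {\<omega>. match \<sigma> \<omega> r}"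
    by (auto simp: match_def)
  finally show ?thesis by (rule borel_open)
qed

lemma cylinder_eq_match: "cylinder \<sigma> = {\<omega>. match \<sigma> \<omega> 0}"
  by (simp add: cylinder_def match_def)

text \<open>Taking the preimage under \<open>shift\<close> moves an occurrence by one
  position.\<close>

lemma measure_match:
  assumes "shift_invariant_prob \<mu>"
  shows "measure \<mu> {\<omega>. match \<sigma> \<omega> r} = measure \<mu> (cylinder \<sigma>)"
proof (induction r)
  case (Suc r)
  have "{\<omega>. match \<sigma> \<omega> (Suc r)} = shift -` {\<omega>. match \<sigma> \<omega> r}"
    by (simp add: match_def shift_def vimage_def)
  then have "measure \<mu> {\<omega>. match \<sigma> \<omega> (Suc r)} = measure \<mu> {\<omega>. match \<sigma> \<omega> r}"
    using assms borel_match unfolding shift_invariant_prob_def by metis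
  then show ?case using Suc by simp
qed (simp add: cylinder_eq_match)

lemma mem_cylinder_word: "\<omega> \<in> cylinder (word L x) \<longleftrightarrow> (\<forall>i<L. \<omega> i = bit x (L - 1 - i))"
  by (simp add: cylinder_def nth_word)

text \<open>A common point would make the lowest \<open>L\<close> bits of both numbers equal, and
  below \<open>2 ^ L\<close> these bits determine the number.\<close>

lemma disjoint_cylinder_word: "disjoint_family_on (\<lambda>x. cylinder (word L x)) {..<2 ^ L}"
unfolding disjoint_family_on_def
proof (intro ballI impI, rule ccontr)
  fix x y assume xy: "x \<in> {..<2 ^ L}" "y \<in> {..<2 ^ L}" "x \<noteq> y"
    and "cylinder (word L x) \<inter> cylinder (word L y) \<noteq> {}"
  then have *: "\<forall>i<L. bit x (L - 1 - i) = bit y (L - 1 - i)"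
    by (auto simp: mem_cylinder_word)
  have "bit x n = bit y n" if "n < L" for n
    using *[rule_format, of "L - 1 - n"] that by simp
  then have "take_bit L x = take_bit L y"
    by (intro bit_eqI) (auto simp: bit_take_bit_iff)
  with xy show False by (simp add: take_bit_nat_eq_self)
qed

lemma cylinder_word_exhaust: "\<exists>x<2 ^ L. \<omega> \<in> cylinder (word L x)"
proof -
  \<comment> \<open>The prefix is reversed because \<open>horner_sum\<close> reads the least
    significant bit first.\<close>
  let ?bs = "map (\<lambda>i. \<omega> (L - 1 - i)) [0..<L]"
  have "horner_sum of_bool 2 ?bs < (2 :: nat) ^ length ?bs"
    by (rule horner_sum_of_bool_2_less)
  moreover have "\<omega> \<in> cylinder (word L (horner_sum of_bool 2 ?bs))"
    by (simp add: mem_cylinder_word bit_horner_sum_bit_iff)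
  ultimately show ?thesis by auto
qed

text \<open>An occurrence that ends within the first \<open>L\<close> coordinates is decided by the
  word there, so the event is a disjoint union of word cylinders. By invariance its measure does not
  depend on \<open>r\<close>.\<close>

lemma sum_measure_cylinder_word:
  assumes \<mu>: "shift_invariant_prob \<mu>" and r: "r + length \<sigma> \<le> L"
  shows "(\<Sum>x<2 ^ L. measure \<mu> (cylinder (word L x)) *
      of_bool (match \<sigma> (\<lambda>i. bit x (L - 1 - i)) r)) = measure \<mu> (cylinder \<sigma>)"
proof -
  interpret prob_space \<mu> using \<mu> by (simp add: shift_invariant_prob_def)
  define X :: "nat set" where "X = {x \<in> {..<2 ^ L}. match \<sigma> (\<lambda>i. bit x (L - 1 - i)) r}"
  have "{\<omega>. match \<sigma> \<omega> r} = (\<Union>x\<in>X. cylinder (word L x))"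
  proof (intro equalityI subsetI)
    fix \<omega> assume \<omega>: "\<omega> \<in> {\<omega>. match \<sigma> \<omega> r}"
    obtain x where x: "x < 2 ^ L" "\<omega> \<in> cylinder (word L x)"
      using cylinder_word_exhaust by blast
    with \<omega> r have "x \<in> X" by (auto simp: X_def mem_cylinder_word match_def)
    with x show "\<omega> \<in> (\<Union>x\<in>X. cylinder (word L x))" by blast
  qed (use r in \<open>auto simp: X_def mem_cylinder_word match_def\<close>)
  moreover have "measure \<mu> (\<Union>x\<in>X. cylinder (word L x)) =
      (\<Sum>x\<in>X. measure \<mu> (cylinder (word L x)))"
  proof (rule finite_measure_finite_Union)
    show "disjoint_family_on (\<lambda>x. cylinder (word L x)) X"
      by (rule disjoint_family_on_mono[OF _ disjoint_cylinder_word]) (auto simp: X_def)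
    show "(\<lambda>x. cylinder (word L x)) ` X \<subseteq> sets \<mu>"
      using \<mu> borel_match by (auto simp: shift_invariant_prob_def cylinder_eq_match)
  qed (simp add: X_def)
  moreover have "(\<Sum>x<2 ^ L. measure \<mu> (cylinder (word L x)) *
      of_bool (match \<sigma> (\<lambda>i. bit x (L - 1 - i)) r)) = (\<Sum>x\<in>X. measure \<mu> (cylinder (word L x)))"
    by (intro sum.mono_neutral_cong_right) (auto simp: X_def)
  ultimately show ?thesis using measure_match[OF \<mu>, of \<sigma> r] by simp
qed

text \<open>This is the case of the empty string, which matches everywhere and whose cylinder is the
  whole space.\<close>

lemma sum_measure_cylinder_word_eq_1:
  assumes "shift_invariant_prob \<mu>"
  shows "(\<Sum>x<2 ^ L. measure \<mu> (cylinder (word L x))) = 1"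
proof -
  interpret prob_space \<mu> using assms by (simp add: shift_invariant_prob_def)
  have "space \<mu> = UNIV"
    using assms sets_eq_imp_space_eq[of \<mu> borel] by (simp add: shift_invariant_prob_def)
  then show ?thesis
    using sum_measure_cylinder_word[OF assms, of 0 "[]" L] prob_space
    by (simp add: match_def cylinder_def)
qed

section \<open>Frequencies along the point\<close>

lemma abs_diff_mult_divide:
  fixes c :: real
  assumes "c > 0"
  shows "\<bar>s - c * a\<bar> / c = \<bar>s / c - a\<bar>"
proof -
  have "s - c * a = c * (s / c - a)" using assms by (simp add: right_diff_distrib)
  then show ?thesis using assms by (simp add: abs_mult)
qed

text \<open>Moving the window by one exchanges \<open>g x\<close> for the equal value
  \<open>g (x + T)\<close>.\<close>

lemma sum_one_period:
  fixes g :: "nat \<Rightarrow> 'a :: ab_group_add"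
  assumes "\<And>i. g (i + T) = g i"
  shows "(\<Sum>i=x..<x + T. g i) = (\<Sum>i<T. g i)"
proof (induction x)
  case (Suc x)
  have "(\<Sum>i=Suc x..<Suc x + T. g i) + g x = (\<Sum>i=x..<Suc (x + T). g i)"
    by (subst (2) sum.atLeast_Suc_lessThan) (auto simp: add.commute)
  also have "\<dots> = (\<Sum>i=x..<x + T. g i) + g x"
    by (simp add: assms)
  finally show ?case using Suc by simp
qed (simp add: lessThan_atLeast0)

text \<open>A crude bound for positions without further information: incomplete periods, offsets at
  which the string overlaps the end of a block, and the early stages.\<close>

lemma abs_sum_diff_card_le:
  fixes g :: "'a \<Rightarrow> real" and a :: real
  assumes "\<And>i. 0 \<le> g i" "\<And>i. g i \<le> 1" "0 \<le> a" "a \<le> 1"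
  shows "\<bar>(\<Sum>i\<in>A. g i) - card A * a\<bar> \<le> card A"
proof -
  have "\<bar>g i - a\<bar> \<le> 1" for i
    using assms(1,2)[of i] assms(3,4) by (simp add: abs_le_iff)
  then have "\<bar>\<Sum>i\<in>A. g i - a\<bar> \<le> (\<Sum>i\<in>A. 1)"
    by (intro order_trans[OF sum_abs] sum_mono)
  then show ?thesis by (simp add: sum_subtractf)
qed

text \<open>Whole periods contribute exactly \<open>T * a\<close> and are stripped off one by one;
  only a remainder shorter than \<open>T\<close> causes an error.\<close>

lemma sum_periodic_interval:
  fixes g :: "nat \<Rightarrow> real" and a :: real
  assumes period: "\<And>i. g (i + T) = g i" and "T > 0"
    and g: "\<And>i. 0 \<le> g i" "\<And>i. g i \<le> 1"
    and avg: "(\<Sum>i<T. g i) = T * a"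
  shows "\<bar>(\<Sum>i=x..<x + m. g i) - m * a\<bar> \<le> T"
proof (induction m arbitrary: x rule: less_induct)
  case (less m)
  have "0 \<le> (\<Sum>i<T. g i)" "(\<Sum>i<T. g i) \<le> (\<Sum>i<T. 1)"
    by (intro sum_nonneg sum_mono g)+
  then have "0 \<le> real T * a" "real T * a \<le> real T * 1"
    by (simp_all add: avg)
  with \<open>T > 0\<close> have a: "0 \<le> a" "a \<le> 1"
    by (simp_all add: zero_le_mult_iff)
  show ?case
  proof (cases "m < T")
    case True
    have "\<bar>(\<Sum>i=x..<x + m. g i) - m * a\<bar> \<le> m"
      using abs_sum_diff_card_le[of g a "{x..<x + m}"] g a by simp
    with True show ?thesis by linarith
  next
    case False
    then obtain k where m: "m = T + k" using le_Suc_ex not_less by blast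
    have "(\<Sum>i=x..<x + m. g i) = (\<Sum>i=x..<x + T. g i) + (\<Sum>i=x + T..<x + T + k. g i)"
      by (simp add: m sum.atLeastLessThan_concat add.assoc)
    also have "(\<Sum>i=x..<x + T. g i) = T * a"
      using sum_one_period[of g, OF period] avg by simp
    finally have "(\<Sum>i=x..<x + m. g i) - m * a = (\<Sum>i=x + T..<x + T + k. g i) - k * a"
      by (simp add: m algebra_simps)
    then show ?thesis using less[of k "x + T"] \<open>T > 0\<close> m by simp
  qed
qed

lemma stage_seq_period: "stage_seq h L (k + L * 4 ^ L) = stage_seq h L k"
  by (cases "L = 0") (simp_all add: stage_seq_def)

lemma match_stage_seq_block:
  assumes "r + length \<sigma> \<le> L" "b < 4 ^ L"
  shows "match \<sigma> (stage_seq h L) (b * L + r) \<longleftrightarrow>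
    match \<sigma> (\<lambda>i. bit (quantile (block_count h L) (2 ^ L) b) (L - 1 - i)) r"
proof -
  have "stage_seq h L (b * L + r + l) =
      bit (quantile (block_count h L) (2 ^ L) b) (L - 1 - (r + l))" if "l < length \<sigma>" for l
  proof -
    have "r + l < L" using that assms by simp
    then have "(b * L + r + l) div L = b" "(b * L + r + l) mod L = r + l"
      by (simp_all add: add.assoc)
    with assms show ?thesis by (simp add: stage_seq_def)
  qed
  then show ?thesis by (simp add: match_def)
qed

text \<open>Regroups positions by their offset \<open>r\<close> within a block, since
  \<open>\<mu>\<close> is approximated separately at each offset.\<close>

lemma sum_interval_mult:
  "(\<Sum>i<L * K. g i) = (\<Sum>r<L. \<Sum>b<K. g (b * L + r))" for g :: "nat \<Rightarrow> 'a :: comm_monoid_add"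
proof -
  have "(\<Sum>i<L * K. g i) = (\<Sum>b<K. \<Sum>i=b * L..<b * L + L. g i)"
    by (simp add: sum.nat_group mult.commute)
  also have "\<dots> = (\<Sum>b<K. \<Sum>r<L. g (b * L + r))"
    by (simp add: sum.atLeastLessThan_shift_0[of g "_ * L"] lessThan_atLeast0)
  finally show ?thesis by (simp add: sum.swap[of _ "{..<L}"])
qed

section \<open>Error bounds for a fixed measure and representation\<close>

context
  fixes \<mu> f
  assumes \<mu>: "shift_invariant_prob \<mu>" and f: "is_representation \<mu> f"
begin

abbreviation (input) mass :: "bool list \<Rightarrow> real" where
  "mass \<sigma> \<equiv> measure \<mu> (cylinder \<sigma>)"

lemma mass_bounds: "0 \<le> mass \<sigma>" "mass \<sigma> \<le> 1"
proof -
  interpret prob_space \<mu> using \<mu> by (simp add: shift_invariant_prob_def)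
  show "0 \<le> mass \<sigma>" "mass \<sigma> \<le> 1" by simp_all
qed

text \<open>If the string fits into the block at offset \<open>r\<close>,
  \<open>sum_quantile_approx\<close> with \<open>\<delta> = 3\<close> and \<open>2 ^ L\<close> words
  bounds the error by \<open>3 * 2 ^ L\<close> over the \<open>4 ^ L\<close> blocks. At most
  \<open>length \<sigma>\<close> offsets do not fit, and each of them costs at most
  \<open>4 ^ L\<close>.\<close>

lemma stage_seq_average:
  assumes "L > 0"
  shows "\<bar>(\<Sum>i<L * 4 ^ L. of_bool (match \<sigma> (stage_seq (oracle_of f) L) i)) / real (L * 4 ^ L) - mass \<sigma>\<bar>
    \<le> 3 / 2 ^ L + length \<sigma> / L"
proof -
  let ?K = "4 ^ L :: nat"
  let ?g = "\<lambda>i. of_bool (match \<sigma> (stage_seq (oracle_of f) L) i) :: real"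
  let ?q = "quantile (block_count (oracle_of f) L) (2 ^ L)"
  have offset: "\<bar>(\<Sum>b<?K. ?g (b * L + r)) - ?K * mass \<sigma>\<bar>
      \<le> 3 * 2 ^ L + (if r + length \<sigma> \<le> L then 0 else ?K)" for r
  proof (cases "r + length \<sigma> \<le> L")
    case True
    have "(\<Sum>b<?K. ?g (b * L + r)) =
        (\<Sum>b<?K. of_bool (match \<sigma> (\<lambda>i. bit (?q b) (L - 1 - i)) r))"
      using True by (intro sum.cong refl) (simp add: match_stage_seq_block)
    moreover have "\<bar>(\<Sum>b<?K. of_bool (match \<sigma> (\<lambda>i. bit (?q b) (L - 1 - i)) r)) -
        ?K * (\<Sum>x<2 ^ L. mass (word L x) * of_bool (match \<sigma> (\<lambda>i. bit x (L - 1 - i)) r))\<bar>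
      \<le> 3 * real (2 ^ L)"
      by (rule sum_quantile_approx)
        (use block_count_bounds[OF f] sum_measure_cylinder_word_eq_1[OF \<mu>] in auto)
    ultimately show ?thesis
      using True sum_measure_cylinder_word[OF \<mu> True] by simp
  next
    case False
    have "\<bar>(\<Sum>b<?K. ?g (b * L + r)) - ?K * mass \<sigma>\<bar> \<le> ?K"
      using abs_sum_diff_card_le[of "\<lambda>b. ?g (b * L + r)" "mass \<sigma>" "{..<?K}"] mass_bounds
      by (simp del: sum_of_bool_eq)
    then show ?thesis using False by (simp add: add_increasing)
  qed
  have "\<bar>(\<Sum>i<L * ?K. ?g i) - L * ?K * mass \<sigma>\<bar> =
      \<bar>\<Sum>r<L. (\<Sum>b<?K. ?g (b * L + r)) - ?K * mass \<sigma>\<bar>"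
    by (simp add: sum_interval_mult sum_subtractf)
  also have "\<dots> \<le> (\<Sum>r<L. real (3 * 2 ^ L + (if r + length \<sigma> \<le> L then 0 else ?K)))"
    by (rule order_trans[OF sum_abs]) (intro sum_mono offset)
  also have "\<dots> = L * (3 * 2 ^ L) + card ({..<L} \<inter> - {r. r + length \<sigma> \<le> L}) * ?K"
    by (simp add: sum.distrib sum.If_cases flip: of_nat_sum)
  also have "\<dots> \<le> L * (3 * 2 ^ L) + length \<sigma> * ?K"
  proof -
    have "{..<L} \<inter> - {r. r + length \<sigma> \<le> L} \<subseteq> {L - length \<sigma>..<L}" by auto
    then have "card ({..<L} \<inter> - {r. r + length \<sigma> \<le> L}) \<le> card {L - length \<sigma>..<L}"
      by (intro card_mono) auto
    also have "\<dots> \<le> length \<sigma>" by simp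
    finally show ?thesis by (intro of_nat_mono add_left_mono mult_right_mono) auto
  qed
  finally have "\<bar>(\<Sum>i<L * ?K. ?g i) - L * ?K * mass \<sigma>\<bar> \<le> L * (3 * 2 ^ L) + length \<sigma> * ?K" .
  then have "\<bar>(\<Sum>i<L * ?K. ?g i) - L * ?K * mass \<sigma>\<bar> / (L * ?K) \<le>
      (L * (3 * 2 ^ L) + length \<sigma> * ?K) / (L * ?K)"
    by (intro divide_right_mono) auto
  also have "\<dots> = 3 / 2 ^ L + length \<sigma> / L"
  proof -
    have "(4 :: real) ^ L = 2 ^ L * 2 ^ L" by (simp flip: power_mult_distrib)
    then show ?thesis using assms by (simp add: field_simps)
  qed
  also have "\<bar>(\<Sum>i<L * ?K. ?g i) - L * ?K * mass \<sigma>\<bar> / (L * ?K) =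
      \<bar>(\<Sum>i<L * ?K. ?g i) / (L * ?K) - mass \<sigma>\<bar>"
    using assms by (intro abs_diff_mult_divide) simp
  finally show ?thesis by simp
qed

text \<open>The three error terms come from an incomplete period, from occurrences that start in the
  last \<open>length \<sigma>\<close> positions and may read past the segment, and from the average
  over one period.\<close>

lemma point_segment:
  assumes "L > 0" "2 ^ L\<^sup>2 \<le> x" "x + m \<le> 2 ^ (Suc L)\<^sup>2"
  shows "\<bar>(\<Sum>i=x..<x + m. of_bool (match \<sigma> (point (oracle_of f)) i)) - m * mass \<sigma>\<bar>
    \<le> L * 4 ^ L + length \<sigma> + m * (3 / 2 ^ L + length \<sigma> / L)"
proof -
  let ?g = "\<lambda>i. of_bool (match \<sigma> (point (oracle_of f)) i) :: real"
  let ?s = "\<lambda>i. of_bool (match \<sigma> (stage_seq (oracle_of f) L) i) :: real"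
  define a where "a = (\<Sum>i<L * 4 ^ L. ?s i) / real (L * 4 ^ L)"
  have "?g i = ?s i" if "x \<le> i" "i + length \<sigma> \<le> x + m" for i
  proof -
    have "stage (i + l) = L" if "l < length \<sigma>" for l
      using that \<open>x \<le> i\<close> \<open>i + length \<sigma> \<le> x + m\<close> assms by (intro stage_eqI) auto
    then show ?thesis by (simp add: match_def point_def)
  qed
  then have "\<bar>?g i - ?s i\<bar> \<le> of_bool (i \<in> {x + m - length \<sigma>..<x + m})"
    if "i \<in> {x..<x + m}" for i
    using that by (cases "i + length \<sigma> \<le> x + m") auto
  then have "(\<Sum>i=x..<x + m. \<bar>?g i - ?s i\<bar>) \<le>
      (\<Sum>i=x..<x + m. of_bool (i \<in> {x + m - length \<sigma>..<x + m}))"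
    by (rule sum_mono)
  also have "\<dots> = card ({x..<x + m} \<inter> {x + m - length \<sigma>..<x + m})"
    by (subst sum_of_bool_eq) (simp_all only: finite_atLeastLessThan Collect_mem_eq)
  also have "\<dots> \<le> length \<sigma>"
    using card_mono[of "{x + m - length \<sigma>..<x + m}" "{x..<x + m} \<inter> {x + m - length \<sigma>..<x + m}"]
    by simp
  finally have "\<bar>\<Sum>i=x..<x + m. ?g i - ?s i\<bar> \<le> length \<sigma>"
    using sum_abs[of "\<lambda>i. ?g i - ?s i" "{x..<x + m}"] by linarith
  then have "\<bar>(\<Sum>i=x..<x + m. ?g i) - (\<Sum>i=x..<x + m. ?s i)\<bar> \<le> length \<sigma>"
    by (simp add: sum_subtractf)
  moreover have "\<bar>(\<Sum>i=x..<x + m. ?s i) - m * a\<bar> \<le> real (L * 4 ^ L)"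
  proof (rule sum_periodic_interval)
    show "?s (i + L * 4 ^ L) = ?s i" for i
    proof -
      have "stage_seq h L (i + L * 4 ^ L + l) = stage_seq h L (i + l)" for h l
        using stage_seq_period[of h L "i + l"] by (simp add: ac_simps)
      then show ?thesis by (simp add: match_def)
    qed
  qed (use assms in \<open>simp_all add: a_def\<close>)
  moreover have "\<bar>m * a - m * mass \<sigma>\<bar> \<le> m * (3 / 2 ^ L + length \<sigma> / L)"
  proof -
    have "\<bar>a - mass \<sigma>\<bar> \<le> 3 / 2 ^ L + length \<sigma> / L"
      unfolding a_def by (rule stage_seq_average[OF assms(1)])
    then show ?thesis by (simp add: abs_mult mult_left_mono flip: right_diff_distrib)
  qed
  ultimately show ?thesis by simp
qed

text \<open>With \<open>L\<close> the stage of \<open>n\<close> and \<open>K = L - 1\<close>, the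
  positions below \<open>n\<close> are cut at the starts of stages \<open>K\<close> and
  \<open>L\<close>. Everything before stage \<open>K\<close> is short enough for the trivial bound.
  Stage \<open>K\<close> has to be estimated properly, because \<open>n\<close> may lie just past
  its end.\<close>

lemma point_discrepancy:
  assumes "b > 0" "n \<ge> 2 ^ (16 * Suc (length \<sigma>) * b)\<^sup>2"
  shows "\<bar>mass \<sigma> - frequency \<sigma> (point (oracle_of f)) n\<bar> < 1 / b"
proof -
  let ?g = "\<lambda>i. of_bool (match \<sigma> (point (oracle_of f)) i) :: real"
  let ?j = "length \<sigma>"
  define L where "L = stage n"
  define K where "K = L - 1"
  have LQ: "16 * Suc ?j * b \<le> L"
    unfolding L_def using assms by (intro stage_mono)
  have "1 * 1 \<le> Suc ?j * b" using assms by (intro mult_le_mono) auto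
  with LQ have L: "16 \<le> L" by linarith
  have "?j * 1 \<le> 16 * Suc ?j * b" using assms by (intro mult_le_mono) auto
  with LQ have jL: "?j \<le> L" by linarith
  have KL: "L = Suc K" "K > 0" using L by (auto simp: K_def)
  \<comment> \<open>Passing from \<open>L\<close> to \<open>K\<close> costs 1, at most one of the 16
    copies of \<open>Suc ?j * b\<close>.\<close>
  have KQ: "15 * Suc ?j * b \<le> K" using LQ KL \<open>1 * 1 \<le> Suc ?j * b\<close> by linarith
  have "(1 :: nat) \<le> (16 * Suc ?j * b)\<^sup>2"
    by (rule one_le_power) (use \<open>1 * 1 \<le> Suc ?j * b\<close> in linarith)
  then have "(2 :: nat) ^ 1 \<le> 2 ^ (16 * Suc ?j * b)\<^sup>2" by (rule power_increasing) simp
  with assms have "n \<ge> 2" by simp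
  then have n: "2 ^ L\<^sup>2 \<le> n" "n < 2 ^ (Suc L)\<^sup>2"
    unfolding L_def by (rule stage_bounds)+
  \<comment> \<open>The average error of stage \<open>K\<close> dominates that of stage
    \<open>L\<close>, so one constant serves both segments.\<close>
  define e where "e = 3 / 2 ^ K + ?j / K"
  have e0: "e \<ge> 0" by (simp add: e_def)
  have eL: "3 / 2 ^ L + ?j / L \<le> e"
    unfolding e_def KL(1) using KL(2) by (intro add_mono divide_left_mono power_increasing) auto
  have PK: "(2 :: nat) ^ K\<^sup>2 \<le> 2 ^ L\<^sup>2"
    by (intro power_increasing power_mono) (auto simp: KL)
  have split: "(\<Sum>i<n. ?g i) = (\<Sum>i<2 ^ K\<^sup>2. ?g i) +
      (\<Sum>i=2 ^ K\<^sup>2..<2 ^ K\<^sup>2 + (2 ^ L\<^sup>2 - 2 ^ K\<^sup>2). ?g i) +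
      (\<Sum>i=2 ^ L\<^sup>2..<2 ^ L\<^sup>2 + (n - 2 ^ L\<^sup>2). ?g i)"
    using PK n
    by (simp add: lessThan_atLeast0 sum.atLeastLessThan_concat del: sum_of_bool_eq)
  have S0: "\<bar>(\<Sum>i<2 ^ K\<^sup>2. ?g i) - (2 ^ K\<^sup>2 :: nat) * mass \<sigma>\<bar> \<le> (2 ^ K\<^sup>2 :: nat)"
    using abs_sum_diff_card_le[of ?g "mass \<sigma>" "{..<2 ^ K\<^sup>2}"] mass_bounds
    by (simp del: sum_of_bool_eq)
  have S1: "\<bar>(\<Sum>i=2 ^ K\<^sup>2..<2 ^ K\<^sup>2 + (2 ^ L\<^sup>2 - 2 ^ K\<^sup>2). ?g i) - (2 ^ L\<^sup>2 - 2 ^ K\<^sup>2 :: nat) * mass \<sigma>\<bar>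
      \<le> K * 4 ^ K + ?j + (2 ^ L\<^sup>2 - 2 ^ K\<^sup>2 :: nat) * e"
    unfolding e_def using PK by (intro point_segment) (auto simp: KL)
  have S2: "\<bar>(\<Sum>i=2 ^ L\<^sup>2..<2 ^ L\<^sup>2 + (n - 2 ^ L\<^sup>2). ?g i) - (n - 2 ^ L\<^sup>2) * mass \<sigma>\<bar>
      \<le> L * 4 ^ L + ?j + (n - 2 ^ L\<^sup>2) * e"
  proof -
    have "\<bar>(\<Sum>i=2 ^ L\<^sup>2..<2 ^ L\<^sup>2 + (n - 2 ^ L\<^sup>2). ?g i) - (n - 2 ^ L\<^sup>2) * mass \<sigma>\<bar>
      \<le> L * 4 ^ L + ?j + (n - 2 ^ L\<^sup>2) * (3 / 2 ^ L + ?j / L)"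
      using n L by (intro point_segment) auto
    also have "\<dots> \<le> L * 4 ^ L + ?j + (n - 2 ^ L\<^sup>2) * e"
      by (intro add_left_mono mult_left_mono eL) simp
    finally show ?thesis .
  qed
  have mult_eq: "n * c = (2 ^ K\<^sup>2 :: nat) * c + (2 ^ L\<^sup>2 - 2 ^ K\<^sup>2 :: nat) * c + (n - 2 ^ L\<^sup>2) * c"
    for c :: real
    using PK n by (simp add: of_nat_diff algebra_simps)
  have "K * 4 ^ K \<le> L * 4 ^ L" by (intro mult_le_mono power_increasing) (auto simp: KL)
  then have "real (K * 4 ^ K) \<le> real (L * 4 ^ L)" by (rule of_nat_mono)
  moreover have "0 \<le> (2 ^ K\<^sup>2 :: nat) * e" using e0 by simp
  ultimately have "\<bar>(\<Sum>i<n. ?g i) - n * mass \<sigma>\<bar> \<le>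
      real (2 ^ K\<^sup>2) + 2 * real (L * 4 ^ L) + 2 * real ?j + n * e"
    using S0 S1 S2 split mult_eq[of "mass \<sigma>"] mult_eq[of e] unfolding abs_le_iff by linarith
  \<comment> \<open>The five terms \<open>n / L\<close> absorb the early stages, two incomplete
    periods and two overlaps at segment ends.\<close>
  also have "\<dots> \<le> n / L + 2 * (n / L) + 2 * (n / L) + n * (3 / K + ?j / K)"
  proof (intro add_mono mult_left_mono)
    have le: "real y \<le> n / L" if "y * L \<le> n" for y
      using that L by (simp add: pos_le_divide_eq flip: of_nat_mult)
    have L2: "L \<le> 2 ^ L" by (simp add: less_imp_le)
    \<comment> \<open>The gain comes from \<open>L\<^sup>2 - K\<^sup>2 = L + K\<close>, which is at
      least \<open>L\<close>.\<close>
    have "2 ^ K\<^sup>2 * L \<le> 2 ^ K\<^sup>2 * 2 ^ L" using L2 by simp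
    also have "\<dots> \<le> 2 ^ L\<^sup>2"
      unfolding power_add[symmetric] by (intro power_increasing) (use KL in \<open>auto simp: power2_eq_square\<close>)
    finally show "real (2 ^ K\<^sup>2) \<le> n / L" using n by (intro le) simp
    \<comment> \<open>The squared exponent in the stage bounds pays off here:
      \<open>2 ^ (4 * L)\<close> is below it once \<open>L \<ge> 4\<close>.\<close>
    have "L * 4 ^ L * L \<le> 2 ^ L * 4 ^ L * 2 ^ L" using L2 by (intro mult_le_mono) auto
    also have "\<dots> = 2 ^ (4 * L)" by (simp add: power_mult flip: power_mult_distrib)
    also have "\<dots> \<le> 2 ^ L\<^sup>2" using L by (intro power_increasing) (auto simp: power2_eq_square)
    finally have *: "L * 4 ^ L * L \<le> n" using n by simp
    then show "real (L * 4 ^ L) \<le> n / L" by (rule le)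
    have "?j * L \<le> L * 4 ^ L * L" using jL by (intro mult_le_mono order_trans[OF jL]) auto
    then show "real ?j \<le> n / L" using * by (intro le) (rule order_trans)
    have "real K \<le> 2 ^ K" by (simp add: less_imp_le)
    then show "e \<le> 3 / K + ?j / K"
      unfolding e_def using KL(2) by (intro add_right_mono divide_left_mono) auto
  qed auto
  also have "\<dots> = n * (5 / L + (3 + ?j) / K)" by (simp add: field_simps add_divide_distrib)
  also have "\<dots> < n * (1 / b)"
  proof (rule mult_strict_left_mono)
    have "16 * b \<le> 16 * Suc ?j * b" by simp
    then have "16 * b \<le> L" using LQ by linarith
    then have "5 / L \<le> 5 / real (16 * b)"
      using assms L by (intro divide_left_mono) (auto simp flip: of_nat_mult)
    moreover have "(3 + ?j) / K \<le> real (3 * Suc ?j) / real (15 * Suc ?j * b)"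
      using KQ assms KL(2) by (intro frac_le) (auto simp del: of_nat_mult)
    moreover have "real (3 * Suc ?j) / real (15 * Suc ?j * b) = 1 / (5 * b)"
      by (simp add: divide_simps)
    ultimately have "5 / L + (3 + ?j) / K \<le> 5 / (16 * b) + 1 / (5 * b)" by simp
    \<comment> \<open>The factor 16 in the bound on \<open>n\<close> is large enough because
      \<open>5 / 16 + 1 / 5 < 1\<close>.\<close>
    also have "\<dots> < 1 / b" using assms by (simp add: field_simps)
    finally show "5 / L + (3 + ?j) / K < 1 / b" .
  qed (use \<open>n \<ge> 2\<close> in simp)
  finally have "\<bar>(\<Sum>i<n. ?g i) - n * mass \<sigma>\<bar> / n < 1 / b"
    using \<open>n \<ge> 2\<close> by (simp add: pos_divide_less_eq mult.commute)
  moreover have "\<bar>(\<Sum>i<n. ?g i) - n * mass \<sigma>\<bar> / n = \<bar>(\<Sum>i<n. ?g i) / n - mass \<sigma>\<bar>"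
    using \<open>n \<ge> 2\<close> by (intro abs_diff_mult_divide) simp
  ultimately show ?thesis by (simp only: frequency_eq abs_minus_commute)
qed

end

section \<open>The modulus and the theorem\<close>

text \<open>The second component of \<open>rat_encode \<epsilon>\<close> is the denominator \<open>b\<close> of \<open>\<epsilon>\<close>, and \<open>1 / b \<le> \<epsilon>\<close>.\<close>

definition modulus :: "nat \<Rightarrow> rat \<Rightarrow> nat" where
  "modulus j \<epsilon> = 2 ^ (16 * Suc j * snd (prod_decode (rat_encode \<epsilon>)))\<^sup>2"

lemma computable_modulus_modulus: "computable_modulus modulus"
proof -
  have "computable True 2 (\<lambda>h xs. 2 ^ (16 * Suc (xs ! 0) * snd (prod_decode (xs ! 1)))\<^sup>2)"
    by (intro computable_intros) auto
  then obtain p where "oracle_free p"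
    and p: "\<And>h xs. length xs = 2 \<Longrightarrow>
      eval h p xs = Some (2 ^ (16 * Suc (xs ! 0) * snd (prod_decode (xs ! 1)))\<^sup>2)"
    unfolding computable_def by blast
  then have "eval h p [j, rat_encode \<epsilon>] = Some (modulus j \<epsilon>)" for h j \<epsilon>
    by (simp add: modulus_def)
  with \<open>oracle_free p\<close> show ?thesis unfolding computable_modulus_def by blast
qed

lemma frequency_point_modulus:
  assumes "shift_invariant_prob \<mu>" "is_representation \<mu> f"
    and "\<epsilon> > 0" "n \<ge> modulus (length \<sigma>) \<epsilon>"
  shows "\<bar>measure \<mu> (cylinder \<sigma>) - frequency \<sigma> (point (oracle_of f)) n\<bar> < of_rat \<epsilon>"
proof -
  obtain a b where ab: "quotient_of \<epsilon> = (a, b)" by (cases "quotient_of \<epsilon>")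
  note d = rat_decode[OF ab]
  have "0 < real_of_rat \<epsilon>" using \<open>\<epsilon> > 0\<close> by simp
  with d have "a \<ge> 1" by (simp add: zero_less_divide_iff)
  then have "1 / real (nat b) \<le> of_rat \<epsilon>" using d(1) by (simp add: d(2) divide_right_mono)
  moreover have "\<bar>measure \<mu> (cylinder \<sigma>) - frequency \<sigma> (point (oracle_of f)) n\<bar> < 1 / nat b"
    using assms d by (intro point_discrepancy) (auto simp: modulus_def)
  ultimately show ?thesis by simp
qed

theorem theorem4p2:
  shows "\<exists>m :: nat \<Rightarrow> rat \<Rightarrow> nat. computable_modulus m \<and>
    (\<exists>p. \<forall>\<mu> f. shift_invariant_prob \<mu> \<longrightarrow> is_representation \<mu> f \<longrightarrow>
      (\<exists>\<omega>. computes_from p f \<omega> \<and> generic \<mu> \<omega> \<and>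
        (\<forall>j \<sigma> \<epsilon> n. length \<sigma> = j \<and> \<epsilon> > 0 \<and> n \<ge> m j \<epsilon> \<longrightarrow>
          \<bar>measure \<mu> (cylinder \<sigma>) - frequency \<sigma> \<omega> n\<bar> < of_rat \<epsilon>)))"
proof -
  \<comment> \<open>The term \<open>p\<close> is fixed before \<open>\<mu>\<close> and
    \<open>f\<close>, which enter only through the oracle.\<close>
  have "computable False 1 (\<lambda>h xs. of_bool (point h (xs ! 0)))"
    by (intro computable_point computable_nth) simp
  then obtain p where
    p: "\<And>h xs. length xs = 1 \<Longrightarrow> eval h p xs = Some (of_bool (point h (xs ! 0)))"
    unfolding computable_def by blast
  have "computes_from p f (point (oracle_of f))" for f
    by (simp add: computes_from_def p)
  moreover have "generic \<mu> (point (oracle_of f))"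
    if "shift_invariant_prob \<mu>" "is_representation \<mu> f" for \<mu> f
    unfolding generic_def
  proof (intro allI LIMSEQ_I)
    fix \<sigma> and r :: real assume "r > 0"
    \<comment> \<open>The modulus takes rational tolerances, so a positive rational below
      \<open>r\<close> is chosen; genericity then follows from the modulus.\<close>
    then obtain \<epsilon> where \<epsilon>: "0 < real_of_rat \<epsilon>" "real_of_rat \<epsilon> < r" using of_rat_dense by blast
    have "norm (frequency \<sigma> (point (oracle_of f)) n - measure \<mu> (cylinder \<sigma>)) < r"
      if "n \<ge> modulus (length \<sigma>) \<epsilon>" for n
      using frequency_point_modulus[OF \<open>shift_invariant_prob \<mu>\<close> \<open>is_representation \<mu> f\<close> _ that] \<epsilon>
      by (simp add: abs_minus_commute)
    then show "\<exists>N. \<forall>n\<ge>N. norm (frequency \<sigma> (point (oracle_of f)) n - measure \<mu> (cylinder \<sigma>)) < r"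
      by blast
  qed
  ultimately show ?thesis
    using computable_modulus_modulus frequency_point_modulus
    by (intro exI[of _ modulus] conjI exI[of _ p] allI impI exI[of _ "point (oracle_of _)"]) auto
qed

end
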